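(* Let $X=\mathbb{R}$ with its standard topology. Let $\mathcal{I}$ be an ideal on $\omega$, let $r:\mathbb{R}\to[0,\infty)$ be a bounded and upper semicontinuous function, and let $\mathscr{F}=\{F_\eta:\eta\in\mathbb{R}\}$ be the rough family with $F_\eta=B_{r(\eta)}(\eta)$ for all $\eta\in\mathbb{R}$. Then the maps $\Phi:c^b(\mathcal{I},\mathscr{F})\to\mathcal{H}(\mathbb{R})$ and $\Psi:\ell_\infty\to\mathcal{H}(\mathbb{R})$ defined by $$\Phi(\bm{x}):=\mathsf{Lim}_{\bm{x}}(\mathcal{I},\mathscr{F})\ \text{ for all }\bm{x}\in c^b(\mathcal{I},\mathscr{F}),\qquad \Psi(\bm{x}):=\Gamma_{\bm{x}}(\mathcal{I},\mathscr{F})\ \text{ for all }\bm{x}\in\ell_\infty,$$ are both $\widehat{\tau}$-continuous.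
   Context: $\omega$ is the set of nonnegative integers. An ideal $\mathcal{I}$ on $\omega$ is a family $\mathcal{I}\subseteq\mathcal{P}(\omega)$ closed under subsets and finite unions, containing all finite subsets of $\omega$, and with $\omega\notin\mathcal{I}$. A rough family on a topological space $X$ is a collection $\mathscr{F}=\{F_\eta:\eta\in X\}$ of subsets of $X$ such that $\eta\in F_\eta$ for all $\eta\in X$. $B_\rho(\eta)$ denotes the closed ball with center $\eta$ and radius $\rho$, so here $B_{r(\eta)}(\eta)=[\eta-r(\eta),\eta+r(\eta)]$. For a sequence $\bm{x}=(x_n:n\in\omega)$ in $X$: $\mathsf{Lim}_{\bm{x}}(\mathcal{I},\mathscr{F})$ is the set of all $\eta\in X$ such that $\{n\in\omega:x_n\notin U\}\in\mathcal{I}$ for all open sets $U\subseteq X$ with $F_\eta\subseteq U$; $\Gamma_{\bm{x}}(\mathcal{I},\mathscr{F})$ is the set of all $\eta\in X$ such that $\{n\in\omega:x_n\in U\}\notin\mathcal{I}$ for all open sets $U\subseteq X$ with $F_\eta\subseteq U$. $\ell_\infty$ is the Banach space of bounded real sequences indexed by $\omega$ with the supremum norm, and $c^b(\mathcal{I},\mathscr{F}):=\{\bm{x}\in\ell_\infty:\mathsf{Lim}_{\bm{x}}(\mathcal{I},\mathscr{F})\neq\emptyset\}$ carries the subspace topology. $\mathcal{H}(X)$ is the family of nonempty closed subsets of $X$, endowed with the upper Vietoris topology $\widehat{\tau}$, i.e. the topology generated by the base of sets $\{F\in\mathcal{H}(X):F\subseteq U\}$ with $U\subseteq X$ open. A map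 into $\mathcal{H}(X)$ is $\widehat{\tau}$-continuous if it is continuous with respect to $\widehat{\tau}$. (Under the stated hypotheses both maps do take values in $\mathcal{H}(\mathbb{R})$.) *)

theory Defs
  imports "HOL-Analysis.Analysis"
begin

definition ideal_on_omega :: "nat set set \<Rightarrow> bool" where
  "ideal_on_omega \<I> \<longleftrightarrow>
     (\<forall>A\<in>\<I>. \<forall>B. B \<subseteq> A \<longrightarrow> B \<in> \<I>) \<and>
     (\<forall>A\<in>\<I>. \<forall>B\<in>\<I>. A \<union> B \<in> \<I>) \<and>
     (\<forall>A. finite A \<longrightarrow> A \<in> \<I>) \<and>
     UNIV \<notin> \<I>"

(* A family of subsets of the space indexed by its own points is a function F from points to
   sets. *)
definition rough_family :: "('a::topological_space \<Rightarrow> 'a set) \<Rightarrow> bool" where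
  "rough_family F \<longleftrightarrow> (\<forall>\<eta>. \<eta> \<in> F \<eta>)"

definition rough_Lim ::
  "(nat \<Rightarrow> 'a::topological_space) \<Rightarrow> nat set set \<Rightarrow> ('a \<Rightarrow> 'a set) \<Rightarrow> 'a set" where
  "rough_Lim x \<I> F = {\<eta>. \<forall>U. open U \<and> F \<eta> \<subseteq> U \<longrightarrow> {n. x n \<notin> U} \<in> \<I>}"

definition rough_Gamma ::
  "(nat \<Rightarrow> 'a::topological_space) \<Rightarrow> nat set set \<Rightarrow> ('a \<Rightarrow> 'a set) \<Rightarrow> 'a set" where
  "rough_Gamma x \<I> F = {\<eta>. \<forall>U. open U \<and> F \<eta> \<subseteq> U \<longrightarrow> {n. x n \<in> U} \<notin> \<I>}"

(* As nat is discrete, every function on it is continuous; hence the type of bounded continuous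
   functions from nat to real, with its sup metric, is the Banach space l_infinity. *)
type_synonym ell_infty = "nat \<Rightarrow>\<^sub>C real"

definition bounded_rough_convergent ::
  "nat set set \<Rightarrow> (real \<Rightarrow> real set) \<Rightarrow> ell_infty set" where
  "bounded_rough_convergent \<I> F = {x. rough_Lim (apply_bcontfun x) \<I> F \<noteq> {}}"

definition hyperspace :: "'a::topological_space set set" where
  "hyperspace = {C. closed C \<and> C \<noteq> {}}"

definition upper_Vietoris :: "'a::topological_space set topology" where
  "upper_Vietoris = topology_generated_by {{C \<in> hyperspace. C \<subseteq> U} | U. open U}"

definition upper_semicontinuous :: "('a::topological_space \<Rightarrow> real) \<Rightarrow> bool" where
  "upper_semicontinuous f \<longleftrightarrow> (\<forall>c. open {t. f t < c})"

lemma rough_family_cball: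
  fixes r :: "'a::metric_space \<Rightarrow> real"
  assumes "\<And>\<eta>. 0 \<le> r \<eta>"
  shows "rough_family (\<lambda>\<eta>. cball \<eta> (r \<eta>))"
  using assms by (simp add: rough_family_def)

lemma topspace_upper_Vietoris: "topspace upper_Vietoris = hyperspace"
  unfolding upper_Vietoris_def topology_generated_by_topspace by blast

end

theory Submission
  imports Defs
begin

text \<open>Both maps have the shape \<open>x \<mapsto> {\<eta>. \<forall>e>0. Q x \<eta> (r \<eta> + e)}\<close>, where \<open>Q x \<eta> \<rho>\<close> says that the ball of
  radius \<open>\<rho>\<close> around \<open>\<eta>\<close> contains \<open>\<I>\<close>-almost all (respectively \<open>\<I>\<close>-positively many) terms of \<open>x\<close>. Moving
  \<open>x\<close> and \<open>\<eta>\<close> costs only the distance moved in the radius, so upper semicontinuity of \<open>r\<close> makes the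
  graph closed; boundedness of \<open>r\<close> makes the values locally uniformly bounded. A set-valued map
  with these two properties is upper semicontinuous.\<close>

text \<open>Sequential compactness: if \<open>L (s n)\<close> leaves \<open>U\<close> along
  \<open>s\<close> converging to \<open>x\<close>, the escaping points stay bounded. A subsequential
  limit of them lies in \<open>L x\<close> by the closed graph and outside \<open>U\<close> because
  \<open>- U\<close> is closed.\<close>

lemma open_subset_preimage_if_closed_graph:
  fixes L :: "'a::metric_space \<Rightarrow> 'b::heine_borel set"
  assumes graph: "closed {(x, y). y \<in> L x}"
    and bdd: "\<And>B. bounded B \<Longrightarrow> bounded (\<Union>x\<in>B. L x)"
    and "open U"
  shows "open {x. L x \<subseteq> U}"
proof -
  have "closed {x. \<not> L x \<subseteq> U}"
    unfolding closed_sequential_limits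
  proof (intro allI impI, elim conjE)
    fix s x assume s: "\<forall>n. s n \<in> {x. \<not> L x \<subseteq> U}" and lim: "s \<longlonglongrightarrow> x"
    have "\<forall>n. \<exists>y. y \<in> L (s n) \<and> y \<notin> U" using s by blast
    then obtain t where t: "\<And>n. t n \<in> L (s n)" "\<And>n. t n \<notin> U" by metis
    \<comment> \<open>A convergent sequence has bounded range, so local boundedness of
      \<open>L\<close> applies to the whole of \<open>s\<close> at once.\<close>
    have "bounded (\<Union>y\<in>range s. L y)"
      using lim bdd convergent_imp_bounded by blast
    then have "bounded (range t)"
      by (rule bounded_subset) (use t(1) in blast)
    then obtain y k where k: "strict_mono (k :: nat \<Rightarrow> nat)" "(t \<circ> k) \<longlonglongrightarrow> y"
      using bounded_imp_convergent_subsequence by blast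
    have "(\<lambda>n. ((s \<circ> k) n, (t \<circ> k) n)) \<longlonglongrightarrow> (x, y)"
      using tendsto_Pair[OF LIMSEQ_subseq_LIMSEQ[OF lim k(1)] k(2)] .
    then have "y \<in> L x"
      using closed_sequentially[OF graph] t(1) by fastforce
    moreover have "y \<in> - U"
      using closed_sequentially[of "- U" "t \<circ> k" y] \<open>open U\<close> t(2) k(2) by auto
    ultimately show "x \<in> {x. \<not> L x \<subseteq> U}" by blast
  qed
  moreover have "{x. L x \<subseteq> U} = - {x. \<not> L x \<subseteq> U}" by auto
  ultimately show ?thesis by (simp add: open_Compl)
qed

text \<open>The slack \<open>e\<close> absorbs the errors of passing to the limit: the two
  distances, and the amount by which \<open>r\<close> at nearby points may exceed
  \<open>r \<eta>\<close>, which upper semicontinuity makes small.\<close>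

lemma closed_graph_of_radius_relation:
  fixes Q :: "'a::metric_space \<Rightarrow> 'b::metric_space \<Rightarrow> real \<Rightarrow> bool"
  assumes move: "\<And>x y \<eta> \<zeta> \<rho> \<sigma>. \<lbrakk>Q x \<eta> \<rho>; \<rho> + dist x y + dist \<eta> \<zeta> \<le> \<sigma>\<rbrakk> \<Longrightarrow> Q y \<zeta> \<sigma>"
    and usc: "upper_semicontinuous r"
  shows "closed {(x, \<eta>). \<forall>e>0. Q x \<eta> (r \<eta> + e)}" (is "closed ?G")
  unfolding closed_sequential_limits
proof (intro allI impI, elim conjE)
  fix p l assume p: "\<forall>n. p n \<in> ?G" and lim: "p \<longlonglongrightarrow> l"
  obtain x \<eta> where l: "l = (x, \<eta>)" by fastforce
  have lims: "(\<lambda>n. fst (p n)) \<longlonglongrightarrow> x" "(\<lambda>n. snd (p n)) \<longlonglongrightarrow> \<eta>"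
    using tendsto_fst[OF lim] tendsto_snd[OF lim] by (simp_all add: l)
  have "Q x \<eta> (r \<eta> + e)" if "e > 0" for e
  proof -
    \<comment> \<open>The budget \<open>e\<close> is split into four quarters: the excess of
      \<open>r\<close> at the nearby point, the slack in the radius there, and the two distances
      charged by \<open>move\<close>.\<close>
    have "open {\<zeta>. r \<zeta> < r \<eta> + e / 4}"
      using usc by (simp add: upper_semicontinuous_def)
    then have "\<forall>\<^sub>F n in sequentially. r (snd (p n)) < r \<eta> + e / 4"
      using topological_tendstoD[OF lims(2)] \<open>e > 0\<close> by fastforce
    moreover have "\<forall>\<^sub>F n in sequentially. dist (fst (p n)) x < e / 4"
      "\<forall>\<^sub>F n in sequentially. dist (snd (p n)) \<eta> < e / 4"
      using tendstoD[OF lims(1), of "e / 4"] tendstoD[OF lims(2), of "e / 4"] \<open>e > 0\<close> by simp_all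
    ultimately have "\<forall>\<^sub>F n in sequentially. Q x \<eta> (r \<eta> + e)"
    proof eventually_elim
      case (elim n)
      have "Q (fst (p n)) (snd (p n)) (r (snd (p n)) + e / 4)"
        using p \<open>e > 0\<close> by (auto simp: case_prod_beta)
      then show ?case using elim by (auto elim!: move)
    qed
    then show ?thesis by simp
  qed
  then show "l \<in> ?G" by (simp add: l)
qed

text \<open>On the line, enlarging a closed ball adds points only just beyond its two endpoints, so
  room inside \<open>U\<close> at the endpoints suffices.\<close>

lemma cball_subset_open_imp_ball_subset:
  fixes \<eta> \<rho> :: real
  assumes "open U" "cball \<eta> \<rho> \<subseteq> U" "0 \<le> \<rho>"
  obtains e where "e > 0" "ball \<eta> (\<rho> + e) \<subseteq> U"
proof -
  have "\<eta> - \<rho> \<in> U" "\<eta> + \<rho> \<in> U"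
    using assms by (auto simp: dist_real_def subset_iff)
  then obtain a b where a: "a > 0" "ball (\<eta> - \<rho>) a \<subseteq> U" and b: "b > 0" "ball (\<eta> + \<rho>) b \<subseteq> U"
    using \<open>open U\<close> by (meson openE)
  have "y \<in> cball \<eta> \<rho> \<union> ball (\<eta> - \<rho>) a \<union> ball (\<eta> + \<rho>) b" if "y \<in> ball \<eta> (\<rho> + min a b)" for y
    using that by (auto simp: dist_real_def)
  then have "ball \<eta> (\<rho> + min a b) \<subseteq> U"
    using a b assms(2) by blast
  then show ?thesis using that a b by (metis min_less_iff_conj)
qed

lemma ideal_on_omega_subset:
  "\<lbrakk>ideal_on_omega \<I>; B \<in> \<I>; A \<subseteq> B\<rbrakk> \<Longrightarrow> A \<in> \<I>"
  unfolding ideal_on_omega_def by blast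

text \<open>The balls of radius \<open>r \<eta> + e\<close> are cofinal among the open supersets of
  the closed ball, so they may replace the arbitrary \<open>U\<close>. This brings the limit set
  into the form of a radius relation.\<close>

lemma rough_Lim_cball_iff:
  fixes x :: "nat \<Rightarrow> real"
  assumes I: "ideal_on_omega \<I>" and "0 \<le> r \<eta>"
  shows "\<eta> \<in> rough_Lim x \<I> (\<lambda>\<eta>. cball \<eta> (r \<eta>)) \<longleftrightarrow>
    (\<forall>e>0. {n. x n \<notin> ball \<eta> (r \<eta> + e)} \<in> \<I>)"
proof
  assume "\<eta> \<in> rough_Lim x \<I> (\<lambda>\<eta>. cball \<eta> (r \<eta>))"
  moreover have "cball \<eta> (r \<eta>) \<subseteq> ball \<eta> (r \<eta> + e)" if "e > 0" for e
    using that by auto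
  ultimately show "\<forall>e>0. {n. x n \<notin> ball \<eta> (r \<eta> + e)} \<in> \<I>"
    unfolding rough_Lim_def by blast
next
  assume R: "\<forall>e>0. {n. x n \<notin> ball \<eta> (r \<eta> + e)} \<in> \<I>"
  have "{n. x n \<notin> U} \<in> \<I>" if U: "open U" "cball \<eta> (r \<eta>) \<subseteq> U" for U
  proof -
    obtain e where "e > 0" "ball \<eta> (r \<eta> + e) \<subseteq> U"
      using cball_subset_open_imp_ball_subset[OF U \<open>0 \<le> r \<eta>\<close>] .
    moreover from this have "{n. x n \<notin> U} \<subseteq> {n. x n \<notin> ball \<eta> (r \<eta> + e)}" by blast
    ultimately show ?thesis using R ideal_on_omega_subset[OF I] by blast
  qed
  then show "\<eta> \<in> rough_Lim x \<I> (\<lambda>\<eta>. cball \<eta> (r \<eta>))"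
    by (simp add: rough_Lim_def)
qed

lemma rough_Gamma_cball_iff:
  fixes x :: "nat \<Rightarrow> real"
  assumes I: "ideal_on_omega \<I>" and "0 \<le> r \<eta>"
  shows "\<eta> \<in> rough_Gamma x \<I> (\<lambda>\<eta>. cball \<eta> (r \<eta>)) \<longleftrightarrow>
    (\<forall>e>0. {n. x n \<in> ball \<eta> (r \<eta> + e)} \<notin> \<I>)"
proof
  assume "\<eta> \<in> rough_Gamma x \<I> (\<lambda>\<eta>. cball \<eta> (r \<eta>))"
  moreover have "cball \<eta> (r \<eta>) \<subseteq> ball \<eta> (r \<eta> + e)" if "e > 0" for e
    using that by auto
  ultimately show "\<forall>e>0. {n. x n \<in> ball \<eta> (r \<eta> + e)} \<notin> \<I>"
    unfolding rough_Gamma_def by blast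
next
  assume R: "\<forall>e>0. {n. x n \<in> ball \<eta> (r \<eta> + e)} \<notin> \<I>"
  have "{n. x n \<in> U} \<notin> \<I>" if U: "open U" "cball \<eta> (r \<eta>) \<subseteq> U" for U
  proof -
    obtain e where "e > 0" "ball \<eta> (r \<eta> + e) \<subseteq> U"
      using cball_subset_open_imp_ball_subset[OF U \<open>0 \<le> r \<eta>\<close>] .
    moreover from this have "{n. x n \<in> ball \<eta> (r \<eta> + e)} \<subseteq> {n. x n \<in> U}" by blast
    ultimately show ?thesis using R ideal_on_omega_subset[OF I] by metis
  qed
  then show "\<eta> \<in> rough_Gamma x \<I> (\<lambda>\<eta>. cball \<eta> (r \<eta>))"
    by (simp add: rough_Gamma_def)
qed

lemma ideal_on_omega_UN:
  assumes "ideal_on_omega \<I>" "finite T" "\<And>t. t \<in> T \<Longrightarrow> A t \<in> \<I>"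
  shows "(\<Union>t\<in>T. A t) \<in> \<I>"
  using assms(2,3)
proof (induction T rule: finite_induct)
  case empty
  then show ?case using assms(1) by (simp add: ideal_on_omega_def)
next
  case (insert t T)
  then show ?case using assms(1) by (simp add: ideal_on_omega_def)
qed

text \<open>Otherwise every point has a neighbourhood visited only on a set of the ideal; finitely
  many of these cover \<open>K\<close>, which puts all of \<open>UNIV\<close> into the
  ideal.\<close>

lemma ideal_cluster_point_exists:
  assumes I: "ideal_on_omega \<I>" and "compact K" and K: "range x \<subseteq> K"
  obtains \<eta> where "\<And>U. \<lbrakk>open U; \<eta> \<in> U\<rbrakk> \<Longrightarrow> {n. x n \<in> U} \<notin> \<I>"
proof (rule ccontr)
  assume "\<not> thesis"
  then have "\<forall>\<eta>. \<exists>U. open U \<and> \<eta> \<in> U \<and> {n. x n \<in> U} \<in> \<I>" using that by blast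
  then obtain V where V: "\<And>\<eta>. open (V \<eta>)" "\<And>\<eta>. \<eta> \<in> V \<eta>" "\<And>\<eta>. {n. x n \<in> V \<eta>} \<in> \<I>"
    by metis
  obtain T where T: "T \<subseteq> K" "finite T" "K \<subseteq> (\<Union>t\<in>T. V t)"
    using compactE_image[OF \<open>compact K\<close>, of K V] V by blast
  then have "(\<Union>t\<in>T. {n. x n \<in> V t}) = UNIV"
    using K by blast
  then have "UNIV \<in> \<I>"
    using ideal_on_omega_UN[OF I \<open>finite T\<close>, of "\<lambda>t. {n. x n \<in> V t}"] V(3) by simp
  then show False using I by (simp add: ideal_on_omega_def)
qed

text \<open>An ordinary cluster point \<eta> is also a rough one: since \<eta> lies in
  \<open>F \<eta>\<close>, every open superset of \<open>F \<eta>\<close> is a neighbourhood of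
  \<eta>.\<close>

lemma rough_Gamma_nonempty:
  assumes "ideal_on_omega \<I>" "rough_family F" "bounded (range x)"
  shows "rough_Gamma (x :: nat \<Rightarrow> 'a::heine_borel) \<I> F \<noteq> {}"
proof -
  have "compact (closure (range x))" using assms(3) by (simp add: compact_closure)
  then obtain \<eta> where "\<And>U. \<lbrakk>open U; \<eta> \<in> U\<rbrakk> \<Longrightarrow> {n. x n \<in> U} \<notin> \<I>"
    using ideal_cluster_point_exists[OF assms(1) _ closure_subset] by metis
  then have "\<eta> \<in> rough_Gamma x \<I> F"
    using assms(2) by (auto simp: rough_Gamma_def rough_family_def)
  then show ?thesis by blast
qed

text \<open>Preimages of the generating sets are traces on \<open>S\<close> of the sets in
  \<open>op\<close>. Off \<open>S\<close> the value of \<open>L\<close> may be empty; intersecting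
  with \<open>S\<close> removes such points.\<close>

lemma continuous_map_upper_Vietoris:
  fixes L :: "'a::topological_space \<Rightarrow> 'b::topological_space set"
  assumes "\<And>x. x \<in> S \<Longrightarrow> closed (L x)" "\<And>x. x \<in> S \<Longrightarrow> L x \<noteq> {}"
    and op: "\<And>U. open U \<Longrightarrow> open {x. L x \<subseteq> U}"
  shows "continuous_map (subtopology euclidean S) upper_Vietoris L"
  unfolding upper_Vietoris_def
proof (rule continuous_on_generated_topo)
  have hyp: "L ` S \<subseteq> hyperspace" using assms by (auto simp: hyperspace_def)
  moreover have "hyperspace = \<Union> {{C \<in> hyperspace. C \<subseteq> (U :: 'b set)} | U. open U}"
    using topspace_upper_Vietoris unfolding upper_Vietoris_def topology_generated_by_topspace
    by (rule sym)
  ultimately show "L ` topspace (subtopology euclidean S) \<subseteq> \<Union> {{C \<in> hyperspace. C \<subseteq> U} | U. open U}"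
    by simp
  fix W assume "W \<in> {{C \<in> hyperspace. C \<subseteq> (U :: 'b set)} | U. open U}"
  then obtain U where U: "open U" "W = {C \<in> hyperspace. C \<subseteq> U}" by blast
  then have "L -` W \<inter> S = {x. L x \<subseteq> U} \<inter> S" using hyp by auto
  then show "openin (subtopology euclidean S) (L -` W \<inter> topspace (subtopology euclidean S))"
    using op[OF U(1)] by (metis openin_open Int_commute topspace_euclidean_subtopology)
qed

text \<open>Common core of both maps: \<open>move\<close> yields the closed graph, and
  \<open>near\<close> with the bound on \<open>r\<close> yields bounded values over bounded
  sets.\<close>

lemma radius_relation_continuous_map_upper_Vietoris:
  fixes Q :: "'a::real_normed_vector \<Rightarrow> real \<Rightarrow> real \<Rightarrow> bool"
  assumes move: "\<And>x y \<eta> \<zeta> \<rho> \<sigma>. \<lbrakk>Q x \<eta> \<rho>; \<rho> + dist x y + dist \<eta> \<zeta> \<le> \<sigma>\<rbrakk> \<Longrightarrow> Q y \<zeta> \<sigma>"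
    and near: "\<And>x \<eta> \<rho>. Q x \<eta> \<rho> \<Longrightarrow> \<bar>\<eta>\<bar> \<le> norm x + \<rho>"
    and usc: "upper_semicontinuous r" and "bounded (range r)"
    and L: "\<And>x \<eta>. \<eta> \<in> L x \<longleftrightarrow> (\<forall>e>0. Q x \<eta> (r \<eta> + e))"
    and ne: "\<And>x. x \<in> S \<Longrightarrow> L x \<noteq> {}"
  shows "continuous_map (subtopology euclidean S) upper_Vietoris L"
proof (rule continuous_map_upper_Vietoris[OF _ ne])
  have graph: "closed {(x, \<eta>). \<eta> \<in> L x}"
    unfolding L by (rule closed_graph_of_radius_relation[of Q, OF move usc])
  \<comment> \<open>Each value \<open>L x\<close> is a section of the closed graph.\<close>
  have "closed (Pair x -` {(x, \<eta>). \<eta> \<in> L x})" for x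
    using graph by (rule closed_vimage) (intro continuous_intros)
  then show "closed (L x)" for x by (simp add: vimage_def)
  obtain R where R: "\<And>\<eta>. \<bar>r \<eta>\<bar> \<le> R"
    using \<open>bounded (range r)\<close> by (auto simp: bounded_iff)
  have "bounded (\<Union>x\<in>B. L x)" if B: "bounded B" for B
  proof -
    obtain b where b: "\<And>x. x \<in> B \<Longrightarrow> norm x \<le> b"
      using B by (auto simp: bounded_iff)
    \<comment> \<open>The summand 1 comes from taking \<open>e = 1\<close> in the description of
      \<open>L\<close>.\<close>
    have "norm \<eta> \<le> b + (R + 1)" if "x \<in> B" "\<eta> \<in> L x" for x \<eta>
    proof -
      have "Q x \<eta> (r \<eta> + 1)" using that L by simp
      from near[OF this] b[OF that(1)] R[of \<eta>] show ?thesis by simp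
    qed
    then show ?thesis by (force simp: bounded_iff)
  qed
  then show "open {x. L x \<subseteq> U}" if "open U" for U
    using open_subset_preimage_if_closed_graph[OF graph _ that] by blast
qed

text \<open>The sup metric controls all coordinates at once, so the same index \<open>n\<close>
  serves for both sequences; this gives inclusions between index sets.\<close>

lemma ball_bcontfun_move:
  fixes x y :: "'a::topological_space \<Rightarrow>\<^sub>C 'b::metric_space"
  assumes "apply_bcontfun x n \<in> ball \<eta> \<rho>" "\<rho> + dist x y + dist \<eta> \<zeta> \<le> \<sigma>"
  shows "apply_bcontfun y n \<in> ball \<zeta> \<sigma>"
proof -
  have "dist \<zeta> (apply_bcontfun y n) \<le>
      dist \<eta> \<zeta> + dist \<eta> (apply_bcontfun x n) + dist (apply_bcontfun x n) (apply_bcontfun y n)"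
    by metric
  then show ?thesis using assms dist_bounded[of x n y] by simp
qed

lemma ball_bcontfun_near:
  fixes x :: "'a::topological_space \<Rightarrow>\<^sub>C real"
  assumes "apply_bcontfun x n \<in> ball \<eta> \<rho>"
  shows "\<bar>\<eta>\<bar> \<le> norm x + \<rho>"
  using assms norm_bounded[of x n] by (simp add: dist_real_def)

theorem theorem2p18:
  fixes \<I> :: "nat set set"
    and r :: "real \<Rightarrow> real"
    and F :: "real \<Rightarrow> real set"
  assumes "ideal_on_omega \<I>"
    and "\<And>\<eta>. 0 \<le> r \<eta>"
    and "bounded (range r)"
    and "upper_semicontinuous r"
    and "\<And>\<eta>. F \<eta> = cball \<eta> (r \<eta>)"
  shows "continuous_map (subtopology euclidean (bounded_rough_convergent \<I> F)) upper_Vietoris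
           (\<lambda>x. rough_Lim (apply_bcontfun x) \<I> F) \<and>
         continuous_map (euclidean :: ell_infty topology) upper_Vietoris
           (\<lambda>x. rough_Gamma (apply_bcontfun x) \<I> F)"
proof
  have F: "F = (\<lambda>\<eta>. cball \<eta> (r \<eta>))" using assms(5) by auto
  note sub = ideal_on_omega_subset[OF assms(1)]
  show "continuous_map (subtopology euclidean (bounded_rough_convergent \<I> F)) upper_Vietoris
      (\<lambda>x. rough_Lim (apply_bcontfun x) \<I> F)"
  proof (rule radius_relation_continuous_map_upper_Vietoris
      [where Q = "\<lambda>x \<eta> \<rho>. {n. apply_bcontfun x n \<notin> ball \<eta> \<rho>} \<in> \<I>"])
    fix x y :: ell_infty and \<eta> \<zeta> \<rho> \<sigma> :: real
    assume Q: "{n. apply_bcontfun x n \<notin> ball \<eta> \<rho>} \<in> \<I>"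
    \<comment> \<open>By contraposition, an index at which \<open>y\<close> misses the new ball is
      one at which \<open>x\<close> missed the old ball.\<close>
    show "{n. apply_bcontfun y n \<notin> ball \<zeta> \<sigma>} \<in> \<I>" if "\<rho> + dist x y + dist \<eta> \<zeta> \<le> \<sigma>"
      using ball_bcontfun_move[OF _ that] by (intro sub[OF Q]) blast
    \<comment> \<open>Properness of the ideal forces some term into the ball, and a single term is
      enough to bound \<eta>.\<close>
    have "{n. apply_bcontfun x n \<notin> ball \<eta> \<rho>} \<noteq> UNIV"
      using Q assms(1) unfolding ideal_on_omega_def by metis
    then show "\<bar>\<eta>\<bar> \<le> norm x + \<rho>" using ball_bcontfun_near by blast
  qed (use assms in \<open>auto simp: F rough_Lim_cball_iff bounded_rough_convergent_def simp del: mem_ball\<close>)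
  have "continuous_map (subtopology euclidean UNIV) upper_Vietoris
      (\<lambda>x :: ell_infty. rough_Gamma (apply_bcontfun x) \<I> F)"
  proof (rule radius_relation_continuous_map_upper_Vietoris
      [where Q = "\<lambda>x \<eta> \<rho>. {n. apply_bcontfun x n \<in> ball \<eta> \<rho>} \<notin> \<I>"])
    fix x y :: ell_infty and \<eta> \<zeta> \<rho> \<sigma> :: real
    assume Q: "{n. apply_bcontfun x n \<in> ball \<eta> \<rho>} \<notin> \<I>"
    show "{n. apply_bcontfun y n \<in> ball \<zeta> \<sigma>} \<notin> \<I>" if "\<rho> + dist x y + dist \<eta> \<zeta> \<le> \<sigma>"
      using ball_bcontfun_move[OF _ that] Q sub by (metis (mono_tags, lifting) Collect_mono)
    \<comment> \<open>Here the term in the ball comes from the empty set being finite and so in the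
      ideal.\<close>
    have "{n. apply_bcontfun x n \<in> ball \<eta> \<rho>} \<noteq> {}"
      using Q assms(1) unfolding ideal_on_omega_def by (metis finite.emptyI)
    then show "\<bar>\<eta>\<bar> \<le> norm x + \<rho>" using ball_bcontfun_near by blast
  next
    fix x :: ell_infty
    have "rough_family F" unfolding F using assms(2) by (rule rough_family_cball)
    moreover have "bounded (range (apply_bcontfun x))"
      using norm_bounded[of x] by (auto simp: bounded_iff)
    ultimately show "rough_Gamma (apply_bcontfun x) \<I> F \<noteq> {}"
      using rough_Gamma_nonempty assms(1) by blast
  qed (use assms in \<open>auto simp: F rough_Gamma_cball_iff simp del: mem_ball\<close>)
  then show "continuous_map (euclidean :: ell_infty topology) upper_Vietoris
      (\<lambda>x. rough_Gamma (apply_bcontfun x) \<I> F)"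
    by simp
qed

end
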